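(* Let $\mathcal{F} \subseteq 2^{[n]}$ be a union-closed family. Then $$|\partial^+ \mathcal{F} \setminus \mathcal{F}| \leq 2^{n-1}.$$
   Context: Here $[n] = \{1,\dots,n\}$ and $2^{[n]}$ is the family of all subsets of $[n]$. A family $\mathcal{F} \subseteq 2^{[n]}$ is called union-closed if for every two sets $A, B \in \mathcal{F}$ we have $A \cup B \in \mathcal{F}$. For a subset $A \subseteq [n]$, the upper shadow of $A$ (with respect to $n$) is $\partial^+ A = \{A \cup \{i\} : i \in [n] \setminus A\}$. For a family $\mathcal{F} \subseteq 2^{[n]}$, the upper shadow is $\partial^+ \mathcal{F} = \bigcup_{A \in \mathcal{F}} \partial^+ A$. *)

theory Defs
  imports Complex_Main
begin

definition union_closed :: "'a set set \<Rightarrow> bool" where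
  "union_closed F \<longleftrightarrow> (\<forall>A\<in>F. \<forall>B\<in>F. A \<union> B \<in> F)"

definition upper_shadow_set :: "nat \<Rightarrow> nat set \<Rightarrow> nat set set" where
  "upper_shadow_set n A = {A \<union> {i} | i. i \<in> {1..n} - A}"

definition upper_shadow :: "nat \<Rightarrow> nat set set \<Rightarrow> nat set set" where
  "upper_shadow n F = (\<Union>A\<in>F. upper_shadow_set n A)"

end

theory Submission
  imports Defs
begin

text \<open>
  If two different elements \<open>i\<close>, \<open>j\<close> could be deleted from \<open>X \<notin> F\<close> to land in \<open>F\<close>, then
  \<open>X\<close> would be a union of two members of \<open>F\<close>; so every \<open>X\<close> in \<open>upper_shadow n F - F\<close> has a
  unique colour \<open>i \<in> X\<close> with \<open>X - {i} \<in> F\<close>. The same argument shows that members of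
  \<open>upper_shadow n F - F\<close> that are adjacent in the cube have the same colour. Now use
  Huang's signed adjacency operator \<open>H\<close> of the \<open>n\<close>-cube, which satisfies \<open>H\<^sup>2 = n\<close> and has the
  eigenvalue \<open>- sqrt n\<close> with multiplicity \<open>2 ^ (n - 1)\<close>. If there were more than \<open>2 ^ (n - 1)\<close>
  such sets, some eigenvector for \<open>- sqrt n\<close> would be supported on them. Its restriction to one
  colour \<open>i\<close> lives on the facet of sets containing \<open>i\<close>, where the operator only has norm
  \<open>sqrt (n - 1)\<close>, a contradiction.
\<close>

section \<open>Homogeneous linear systems\<close>

lemma underdetermined_system_nontrivial_solution:
  fixes m :: "'b \<Rightarrow> 'a \<Rightarrow> 'c::field"
  assumes "finite B" "finite A" "card B < card A"
  shows "\<exists>c. (\<exists>a\<in>A. c a \<noteq> 0) \<and> (\<forall>b\<in>B. (\<Sum>a\<in>A. m b a * c a) = 0)"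
  using assms
proof (induction B arbitrary: A m rule: finite_induct)
  case empty
  then obtain a where "a \<in> A" by fastforce
  then show ?case by (intro exI[of _ "\<lambda>_. 1"]) auto
next
  case (insert b B)
  show ?case
  proof (cases "\<forall>a\<in>A. m b a = 0")
    case True
    have "card B < card A" using insert by simp
    from insert.IH[OF insert.prems(1) this, of m] True show ?thesis by auto
  next
    case False
    then obtain p where p: "p \<in> A" "m b p \<noteq> 0" by blast
    \<comment> \<open>Gaussian elimination: equation \<open>b\<close> is solved for the unknown
      \<open>p\<close> and substituted into the others.\<close>
    define m' where "m' b' a = m b' a - m b' p * m b a / m b p" for b' a
    have "card B < card (A - {p})" using insert p by simp
    from insert.IH[OF _ this, of m'] insert.prems obtain c
      where c: "\<exists>a\<in>A - {p}. c a \<noteq> 0" "\<forall>b'\<in>B. (\<Sum>a\<in>A - {p}. m' b' a * c a) = 0" by auto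
    define s where "s = (\<Sum>a\<in>A - {p}. m b a * c a)"
    define d where "d = c(p := - s / m b p)"
    have split: "(\<Sum>a\<in>A. m b' a * d a) = - m b' p * s / m b p + (\<Sum>a\<in>A - {p}. m b' a * c a)" for b'
      using insert.prems p by (simp add: sum.remove[of A p] d_def)
    have "(\<Sum>a\<in>A - {p}. m' b' a * c a) = (\<Sum>a\<in>A - {p}. m b' a * c a) - m b' p * s / m b p" for b'
      by (simp add: m'_def s_def algebra_simps sum_subtractf sum_distrib_left sum_divide_distrib)
    then have "\<forall>b'\<in>B. (\<Sum>a\<in>A. m b' a * d a) = 0" using c(2) split by simp
    moreover have "(\<Sum>a\<in>A. m b a * d a) = 0" using p unfolding split by (simp add: s_def)
    moreover have "\<exists>a\<in>A. d a \<noteq> 0" using c(1) by (auto simp: d_def)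
    ultimately show ?thesis by blast
  qed
qed

section \<open>The signed adjacency operator of the cube\<close>

definition flip :: "'a \<Rightarrow> 'a set \<Rightarrow> 'a set" where
  "flip j X = (if j \<in> X then X - {j} else insert j X)"

lemma flip_flip [simp]: "flip j (flip j X) = X"
  by (auto simp: flip_def)

lemma flip_commute: "flip j (flip k X) = flip k (flip j X)"
  by (auto simp: flip_def)

lemma bij_betw_flip: "j \<in> V \<Longrightarrow> bij_betw (flip j) (Pow V) (Pow V)"
  by (rule bij_betw_byWitness[where f' = "flip j"]) (auto simp: flip_def split: if_splits)

text \<open>Huang's signing of the cube edges. Only elements strictly below \<open>j\<close> count,
  so both ends of an edge in direction \<open>j\<close> carry the same sign.\<close>

definition edge_sign :: "'a::linorder \<Rightarrow> 'a set \<Rightarrow> real" where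
  "edge_sign j X = (- 1) ^ card {k \<in> X. k < j}"

lemma edge_sign_square [simp]: "edge_sign j X * edge_sign j X = 1"
  by (simp add: edge_sign_def flip: power_add)

lemma edge_sign_nonzero [simp]: "edge_sign j X \<noteq> 0"
  by (simp add: edge_sign_def)

lemma edge_sign_flip_ge: "j \<le> k \<Longrightarrow> edge_sign j (flip k X) = edge_sign j X"
proof -
  assume "j \<le> k"
  then have "{i \<in> flip k X. i < j} = {i \<in> X. i < j}" by (auto simp: flip_def)
  then show ?thesis by (simp add: edge_sign_def)
qed

lemma edge_sign_flip_less:
  assumes "finite X" "k < j"
  shows "edge_sign j (flip k X) = - edge_sign j X"
proof -
  have insert: "edge_sign j (insert k Y) = - edge_sign j Y" if "finite Y" "k \<notin> Y" for Y
  proof -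
    have "{i \<in> insert k Y. i < j} = insert k {i \<in> Y. i < j}" using assms by auto
    then show ?thesis using that by (simp add: edge_sign_def)
  qed
  show ?thesis
    using insert[of X] insert[of "X - {k}"] assms by (auto simp: flip_def insert_absorb)
qed

text \<open>Flipping the smaller of \<open>j\<close>, \<open>k\<close> negates the sign in the
  larger direction, but not vice versa. So the two paths across a square have opposite sign
  products.\<close>

lemma edge_sign_square_path:
  assumes "finite X" "j \<noteq> k"
  shows "edge_sign k X * edge_sign j (flip k X) = - (edge_sign j X * edge_sign k (flip j X))"
  using assms by (cases j k rule: linorder_cases) (simp_all add: edge_sign_flip_ge edge_sign_flip_less)

text \<open>The direction set \<open>S\<close> is a parameter so that \<open>V - {i}\<close> gives
  the operator that stays within the facets of direction \<open>i\<close>.\<close>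

definition signed_adj :: "'a::linorder set \<Rightarrow> ('a set \<Rightarrow> real) \<Rightarrow> 'a set \<Rightarrow> real" where
  "signed_adj S f X = (\<Sum>j\<in>S. edge_sign j X * f (flip j X))"

lemma signed_adj_signed_adj:
  assumes "finite S" "finite X"
  shows "signed_adj S (signed_adj S f) X = real (card S) * f X"
proof -
  define t where "t j k = edge_sign j X * edge_sign k (flip j X) * f (flip k (flip j X))" for j k
  have diag: "t j j = f X" for j by (simp add: t_def edge_sign_flip_ge)
  \<comment> \<open>Two-step walks in distinct directions cancel in pairs; the term
    \<open>2 * f X\<close> makes the same identity hold on the diagonal.\<close>
  have anti: "t j k = (if j = k then 2 * f X else 0) - t k j" for j k
    using edge_sign_square_path[OF assms(2), of k j] diag
    by (auto simp: t_def flip_commute[of j k])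
  have eq: "signed_adj S (signed_adj S f) X = (\<Sum>j\<in>S. \<Sum>k\<in>S. t j k)"
    by (simp add: signed_adj_def t_def sum_distrib_left mult.assoc)
  also have "\<dots> = (\<Sum>j\<in>S. \<Sum>k\<in>S. (if j = k then 2 * f X else 0) - t k j)"
    by (intro sum.cong refl anti)
  also have "\<dots> = 2 * real (card S) * f X - (\<Sum>j\<in>S. \<Sum>k\<in>S. t k j)"
    using assms by (simp add: sum_subtractf)
  also have "(\<Sum>j\<in>S. \<Sum>k\<in>S. t k j) = (\<Sum>j\<in>S. \<Sum>k\<in>S. t j k)" by (rule sum.swap)
  finally show ?thesis using eq by simp
qed

lemma signed_adj_self_adjoint:
  assumes "S \<subseteq> V"
  shows "(\<Sum>X\<in>Pow V. signed_adj S f X * g X) = (\<Sum>X\<in>Pow V. f X * signed_adj S g X)"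
proof -
  have "(\<Sum>X\<in>Pow V. edge_sign j X * f (flip j X) * g X)
      = (\<Sum>X\<in>Pow V. f X * (edge_sign j X * g (flip j X)))" if "j \<in> S" for j
    by (subst sum.reindex_bij_betw[OF bij_betw_flip[of j V], symmetric])
       (use that assms in \<open>auto simp: edge_sign_flip_ge algebra_simps\<close>)
  then show ?thesis
    unfolding signed_adj_def sum_distrib_left sum_distrib_right
    by (simp add: sum.swap[of _ S])
qed

lemma sum_signed_adj_square:
  assumes "finite V" "S \<subseteq> V"
  shows "(\<Sum>X\<in>Pow V. (signed_adj S f X)\<^sup>2) = real (card S) * (\<Sum>X\<in>Pow V. (f X)\<^sup>2)"
proof -
  have "(\<Sum>X\<in>Pow V. (signed_adj S f X)\<^sup>2) = (\<Sum>X\<in>Pow V. f X * signed_adj S (signed_adj S f) X)"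
    using signed_adj_self_adjoint[OF assms(2)] by (simp add: power2_eq_square)
  also have "\<dots> = (\<Sum>X\<in>Pow V. real (card S) * (f X)\<^sup>2)"
    using assms
    by (intro sum.cong refl)
       (auto simp: signed_adj_signed_adj finite_subset power2_eq_square)
  finally show ?thesis by (simp add: sum_distrib_left)
qed

text \<open>
  The eigenvalue equation only has to be solved on the half of the cube avoiding \<open>v\<close>: the error
  \<open>u\<close> satisfies \<open>H u = sqrt n u\<close>, and at \<open>Y\<close> avoiding \<open>v\<close> this reads \<open>\<plusminus> u (insert v Y) = 0\<close>.
\<close>

lemma eigenvector_supported_on:
  assumes "finite V" "v \<in> V" "N \<subseteq> Pow V" and card: "2 ^ (card V - 1) < card N"
  obtains f where "\<exists>X\<in>N. f X \<noteq> 0" "\<And>X. X \<notin> N \<Longrightarrow> f X = 0"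
    "\<And>X. X \<subseteq> V \<Longrightarrow> signed_adj V f X = - sqrt (card V) * f X"
proof -
  let ?r = "sqrt (card V)"
  \<comment> \<open>The matrix of H + sqrt n. Only its rows indexed by subsets of
    \<open>V - {v}\<close> are imposed as equations, fewer than the unknowns.\<close>
  define m where
    "m Y X = signed_adj V (\<lambda>Z. of_bool (Z = X)) Y + ?r * of_bool (Y = X)" for Y X
  have finN: "finite N" using assms by (meson finite_Pow_iff finite_subset)
  have "card (Pow (V - {v})) < card N" using assms by (simp add: card_Pow)
  from underdetermined_system_nontrivial_solution[OF _ finN this, of m] assms(1)
  obtain c where c: "\<exists>X\<in>N. c X \<noteq> 0"
    "\<forall>Y\<in>Pow (V - {v}). (\<Sum>X\<in>N. m Y X * c X) = 0" by auto
  define f where "f X = (if X \<in> N then c X else 0)" for X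
  define u where "u X = signed_adj V f X + ?r * f X" for X
  have fsum: "f Z = (\<Sum>X\<in>N. of_bool (Z = X) * c X)" for Z
    using finN by (simp add: f_def of_bool_def if_distrib[where f = "\<lambda>x. x * _"] cong: if_cong)
  have "u Y = (\<Sum>X\<in>N. m Y X * c X)" for Y
    unfolding u_def fsum signed_adj_def m_def
    by (simp add: distrib_right sum.distrib sum_distrib_left sum_distrib_right mult.assoc
        sum.swap[of _ N V])
  then have u0: "u Y = 0" if "Y \<subseteq> V - {v}" for Y using c that by simp
  \<comment> \<open>(H - sqrt n)(H + sqrt n) = H^2 - n = 0.\<close>
  have Hu: "signed_adj V u Y = ?r * u Y" if "Y \<subseteq> V" for Y
  proof -
    have "finite Y" using that assms finite_subset by blast
    have "signed_adj V u Y = signed_adj V (signed_adj V f) Y + ?r * signed_adj V f Y"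
      by (simp add: signed_adj_def u_def algebra_simps sum.distrib sum_distrib_left)
    also have "\<dots> = ?r * u Y"
      using assms \<open>finite Y\<close> by (simp add: signed_adj_signed_adj u_def algebra_simps)
    finally show ?thesis .
  qed
  have "u X = 0" if X: "X \<subseteq> V" for X
  proof (cases "v \<in> X")
    case False
    then show ?thesis using u0 X by blast
  next
    case True
    define Y where "Y = X - {v}"
    have Y: "Y \<subseteq> V - {v}" and flipY: "flip v Y = X" using True X by (auto simp: Y_def flip_def)
    have "u (flip j Y) = 0" if "j \<in> V - {v}" for j
      using that Y by (intro u0) (auto simp: flip_def)
    then have "signed_adj V u Y = edge_sign v Y * u X"
      using assms flipY by (simp add: signed_adj_def sum.remove[of V v])
    moreover have "signed_adj V u Y = 0" using Hu[of Y] u0[OF Y] Y by auto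
    ultimately show ?thesis by simp
  qed
  then show thesis
    using c(1) by (intro that[of f]) (auto simp: f_def u_def eq_neg_iff_add_eq_0)
qed

section \<open>Locally constant colourings\<close>

lemma card_le_half_cube_if_coloured:
  fixes V :: "'a::linorder set"
  assumes "finite V" "V \<noteq> {}" "N \<subseteq> Pow V"
    and col_mem: "\<And>X. X \<in> N \<Longrightarrow> col X \<in> X"
    and col_flip: "\<And>X j. X \<in> N \<Longrightarrow> flip j X \<in> N \<Longrightarrow> col (flip j X) = col X"
  shows "card N \<le> 2 ^ (card V - 1)"
proof (rule ccontr)
  assume "\<not> ?thesis"
  then have "2 ^ (card V - 1) < card N" by simp
  moreover obtain v where "v \<in> V" using assms by blast
  ultimately obtain f X0 where X0: "X0 \<in> N" "f X0 \<noteq> 0"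
    and supp: "\<And>X. X \<notin> N \<Longrightarrow> f X = 0"
    and eig: "\<And>X. X \<subseteq> V \<Longrightarrow> signed_adj V f X = - sqrt (card V) * f X"
    using eigenvector_supported_on assms by (metis (no_types, lifting))
  define i where "i = col X0"
  have iV: "i \<in> V" using X0 col_mem assms(3) i_def by blast
  let ?M = "{X \<in> N. col X = i}"
  define g where "g X = (if X \<in> ?M then f X else 0)" for X
  let ?H = "signed_adj (V - {i}) g"
  have Hg: "?H X = - sqrt (card V) * g X" if X: "X \<in> ?M" for X
  proof -
    \<comment> \<open>Otherwise both ends of this edge would have colour \<open>i\<close>, but only
      one of them contains \<open>i\<close>.\<close>
    have "flip i X \<notin> N"
    proof
      assume "flip i X \<in> N"
      then show False using col_flip[of X i] col_mem[of X] col_mem[of "flip i X"] X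
        by (auto simp: flip_def)
    qed
    then have "signed_adj V f X = signed_adj (V - {i}) f X"
      using assms iV supp by (simp add: signed_adj_def sum.remove[of V i])
    \<comment> \<open>A neighbour of \<open>X\<close> either lies in \<open>N\<close>, hence has
      colour \<open>i\<close>, or lies outside \<open>N\<close>, where \<open>f\<close> and
      \<open>g\<close> both vanish.\<close>
    also have "\<dots> = ?H X"
      unfolding signed_adj_def using X col_flip supp by (intro sum.cong refl) (auto simp: g_def)
    finally show ?thesis using eig[of X] X assms(3) by (auto simp: g_def)
  qed
  let ?G = "\<Sum>X\<in>Pow V. (g X)\<^sup>2"
  \<comment> \<open>Off \<open>?M\<close> the values of \<open>?H\<close> are unknown, but
    \<open>g\<close> is zero there, so an inequality suffices.\<close>
  have "real (card V) * ?G \<le> (\<Sum>X\<in>Pow V. (?H X)\<^sup>2)"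
    unfolding sum_distrib_left
  proof (rule sum_mono)
    fix X
    show "real (card V) * (g X)\<^sup>2 \<le> (?H X)\<^sup>2"
    proof (cases "X \<in> ?M")
      case True
      then show ?thesis by (simp add: Hg power_mult_distrib)
    next
      case False
      then have "g X = 0" unfolding g_def by (rule if_not_P)
      then show ?thesis by simp
    qed
  qed
  also have "\<dots> = real (card V - 1) * ?G"
    using assms iV by (simp add: sum_signed_adj_square)
  also have "\<dots> = real (card V) * ?G - ?G"
    using assms iV by (simp add: of_nat_diff card_gt_0_iff Suc_le_eq algebra_simps)
  finally have "?G \<le> 0" by simp
  moreover have "0 < ?G"
    using assms X0 by (intro sum_pos2[of _ X0]) (auto simp: g_def i_def)
  ultimately show False by simp
qed

section \<open>Union-closed families\<close>

text \<open>If \<open>i\<close> and \<open>k\<close> differ, the two deletions have union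
  \<open>Y\<close>, which is not in \<open>F\<close>. Taking \<open>Y = X\<close> gives uniqueness
  of the colour, \<open>Y = insert j X\<close> its constancy along edges.\<close>

lemma union_closed_deletion_colour_unique:
  assumes "union_closed F" "X \<notin> F" "X \<subseteq> Y" "Y \<notin> F" "Y \<subseteq> insert j X"
    and "i \<in> X" "X - {i} \<in> F" "k \<in> Y" "Y - {k} \<in> F"
  shows "i = k"
proof (rule ccontr)
  assume "i \<noteq> k"
  have "k \<in> X"
  proof (rule ccontr)
    assume "k \<notin> X"
    \<comment> \<open>Here \<open>k\<close> must be \<open>j\<close>, the only element that
      \<open>Y\<close> can have beyond \<open>X\<close>.\<close>
    then have "Y - {k} = X" using assms by auto
    then show False using assms by simp
  qed
  then have "(X - {i}) \<union> (Y - {k}) = Y" using assms \<open>i \<noteq> k\<close> by auto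
  then show False using assms unfolding union_closed_def by metis
qed

theorem theorem1p3:
  fixes n :: nat and F :: "nat set set"
  assumes "F \<subseteq> Pow {1..n}"
    and "union_closed F"
  shows "real (card (upper_shadow n F - F)) \<le> 2 powi (int n - 1)"
proof (cases "n = 0")
  case True
  \<comment> \<open>The bound is 1/2 here, but the shadow is empty because no element can be
    added.\<close>
  then show ?thesis by (simp add: upper_shadow_def upper_shadow_set_def)
next
  case False
  define N where "N = upper_shadow n F - F"
  define col where "col X = (SOME i. i \<in> X \<and> X - {i} \<in> F)" for X
  have sub: "N \<subseteq> Pow {1..n}"
    using assms(1) by (fastforce simp: N_def upper_shadow_def upper_shadow_set_def)
  have col: "col X \<in> X \<and> X - {col X} \<in> F" if X: "X \<in> N" for X
    unfolding col_def
  proof (rule someI_ex)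
    from X obtain A i where "A \<in> F" "i \<notin> A" "X = insert i A"
      by (auto simp: N_def upper_shadow_def upper_shadow_set_def)
    then show "\<exists>i. i \<in> X \<and> X - {i} \<in> F" by (intro exI[of _ i]) simp
  qed
  have "card N \<le> 2 ^ (card {1..n} - 1)"
  proof (rule card_le_half_cube_if_coloured[where col = col])
    fix X j assume X: "X \<in> N" and Y: "flip j X \<in> N"
    then have notF: "X \<notin> F" "flip j X \<notin> F" by (simp_all add: N_def)
    show "col (flip j X) = col X"
    proof (cases "j \<in> X")
      case True
      then have "flip j X \<subseteq> X" "X \<subseteq> insert j (flip j X)" by (auto simp: flip_def)
      then show ?thesis
        using union_closed_deletion_colour_unique[OF assms(2) notF(2) _ notF(1)] col[OF X] col[OF Y]
        by blast
    next
      case False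
      then have "X \<subseteq> flip j X" "flip j X \<subseteq> insert j X" by (auto simp: flip_def)
      then show ?thesis
        using union_closed_deletion_colour_unique[OF assms(2) notF(1) _ notF(2)] col[OF X] col[OF Y]
        by metis
    qed
  qed (use sub col False in auto)
  then have "real (card N) \<le> 2 ^ (n - 1)"
    by (simp flip: of_nat_le_iff)
  also have "(2::real) ^ (n - 1) = 2 powi (int n - 1)"
    using False by (simp add: power_int_def nat_diff_distrib)
  finally show ?thesis by (simp add: N_def)
qed

end
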